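(* Let $0<p<1$, $q=1-p$, $s>0$, and $r=1/q$. Let $X_1,X_2,\dots$ be i.i.d. random variables with $P(X_1=s r^{k-1})=p q^{k-1}$ for $k=1,2,\dots$, and let $S_n=\sum_{k=1}^n X_k$. Then $$\frac{S_n}{n\log_r n}\longrightarrow sp\quad\text{in probability as } n\to\infty .$$
   Context: $\log_r$ denotes the logarithm to base $r$. *)

theory Defs
  imports "HOL-Probability.Probability"
begin

(* Measurability is part of the definition because the measure of a
   non-measurable set is 0 by convention. *)
definition tendsto_in_probability ::
    "'a measure \<Rightarrow> (nat \<Rightarrow> 'a \<Rightarrow> real) \<Rightarrow> ('a \<Rightarrow> real) \<Rightarrow> bool" where
  "tendsto_in_probability M Y Z \<longleftrightarrow>
     (\<forall>n. Y n \<in> borel_measurable M) \<and> Z \<in> borel_measurable M \<and>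
     (\<forall>\<epsilon>>0. (\<lambda>n. measure M {x \<in> space M. \<bar>Y n x - Z x\<bar> > \<epsilon>}) \<longlonglongrightarrow> 0)"

end

(* The X_k have infinite mean, so truncate: keep only the m smallest values s r^j, j < m.
   The truncated variable has mean s p m and second moment at most s^2 q r^m, and truncation
   changes a single summand with probability q^m.  With m about log_r (n log_r n), the union
   bound n q^m and the Chebyshev bound n s^2 q r^m / (n log_r n)^2 are both
   O(1 / log_r n), while the centring n s p m is asymptotic to s p n log_r n. *)
theory Submission
  imports Defs "HOL-Real_Asymp.Real_Asymp"
begin

section \<open>Truncation bounds for a general i.i.d. sum\<close>

text \<open>Each new summand is independent of the sum of the others, so the expectation of the
  cross term factors and vanishes by centring. Integrability goes through the same induction because
  it is what lets the expectation of the expanded square split.\<close>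

lemma (in prob_space) expectation_square_sum_indep:
  fixes Z :: "'i \<Rightarrow> 'a \<Rightarrow> real"
  assumes "finite I" and "indep_vars (\<lambda>_. borel) Z I"
    and "\<And>i. i \<in> I \<Longrightarrow> integrable M (\<lambda>x. (Z i x)\<^sup>2)"
    and "\<And>i. i \<in> I \<Longrightarrow> expectation (Z i) = 0"
  shows "integrable M (\<lambda>x. (\<Sum>i\<in>I. Z i x)\<^sup>2)"
    and "expectation (\<lambda>x. (\<Sum>i\<in>I. Z i x)\<^sup>2) = (\<Sum>i\<in>I. expectation (\<lambda>x. (Z i x)\<^sup>2))"
proof -
  have "integrable M (\<lambda>x. (\<Sum>i\<in>I. Z i x)\<^sup>2) \<and>
    expectation (\<lambda>x. (\<Sum>i\<in>I. Z i x)\<^sup>2) = (\<Sum>i\<in>I. expectation (\<lambda>x. (Z i x)\<^sup>2))"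
    using assms
  proof (induction I rule: finite_induct)
    case empty
    then show ?case by simp
  next
    case (insert i I)
    let ?T = "\<lambda>x. \<Sum>j\<in>I. Z j x"
    have rv: "random_variable borel (Z j)" if "j \<in> insert i I" for j
      using insert.prems(1) that by (auto simp: indep_vars_def)
    have int: "integrable M (Z j)" if "j \<in> insert i I" for j
      using square_integrable_imp_integrable[OF rv insert.prems(2)] that by auto
    have ih: "integrable M (\<lambda>x. (?T x)\<^sup>2)"
      "expectation (\<lambda>x. (?T x)\<^sup>2) = (\<Sum>j\<in>I. expectation (\<lambda>x. (Z j x)\<^sup>2))"
      using insert.IH indep_vars_subset[OF insert.prems(1)] insert.prems by auto
    have intT: "integrable M ?T"
      using int by auto
    have indep: "indep_var borel (Z i) borel ?T"
      using indep_vars_sum[OF insert.hyps insert.prems(1)] .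
    have cross: "integrable M (\<lambda>x. Z i x * ?T x)" "expectation (\<lambda>x. Z i x * ?T x) = 0"
      using indep_var_integrable[OF indep int intT] indep_var_lebesgue_integral[OF indep int intT]
        insert.prems(3) by auto
    have eq: "(\<Sum>j\<in>insert i I. Z j x)\<^sup>2 = (Z i x)\<^sup>2 + 2 * (Z i x * ?T x) + (?T x)\<^sup>2" for x
      using insert.hyps by (simp add: power2_sum)
    have "integrable M (\<lambda>x. (Z i x)\<^sup>2)"
      using insert.prems(2) by simp
    then show ?case
      unfolding eq using cross ih insert.hyps by simp
  qed
  then show "integrable M (\<lambda>x. (\<Sum>i\<in>I. Z i x)\<^sup>2)"
    "expectation (\<lambda>x. (\<Sum>i\<in>I. Z i x)\<^sup>2) = (\<Sum>i\<in>I. expectation (\<lambda>x. (Z i x)\<^sup>2))"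
    by auto
qed

text \<open>The indicator of a finite set is a sum of indicators of singletons, so the integral sees
  only the masses of \<open>D\<close> at the points of \<open>A\<close>. This turns moments of a
  truncated variable into finite sums, whatever \<open>D\<close> does elsewhere.\<close>

lemma integral_mult_indicator_finite:
  fixes h :: "real \<Rightarrow> real"
  assumes "finite_measure D" and [simp]: "sets D = sets borel" and "finite A"
  shows "integrable D (\<lambda>x. h x * indicator A x)"
    and "(\<integral>x. h x * indicator A x \<partial>D) = (\<Sum>a\<in>A. h a * measure D {a})"
proof -
  interpret D: finite_measure D by fact
  have space: "space D = UNIV"
    using sets_eq_imp_space_eq[of D borel] by simp
  have eq: "h x * indicator A x = (\<Sum>a\<in>A. h a * indicator {a} x)" for x
    using \<open>finite A\<close> by (cases "x \<in> A") (auto simp: indicator_def if_distrib sum.delta' cong: if_cong)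
  have "integrable D (indicator {a} :: real \<Rightarrow> real)" for a
    by (simp add: D.emeasure_finite less_top[symmetric])
  then show "integrable D (\<lambda>x. h x * indicator A x)"
    "(\<integral>x. h x * indicator A x \<partial>D) = (\<Sum>a\<in>A. h a * measure D {a})"
    unfolding eq by (simp_all add: space)
qed

text \<open>Replace every value outside \<open>A\<close> by 0. The first term is the union bound for
  the event that this changes some summand; the second is Chebyshev for the truncated sum, with the
  variance of a summand bounded by its second moment.\<close>

lemma (in prob_space) truncated_sum_deviation:
  fixes X :: "'i \<Rightarrow> 'a \<Rightarrow> real"
  assumes "finite I" and "indep_vars (\<lambda>_. borel) X I"
    and distr: "\<And>i. i \<in> I \<Longrightarrow> distr M borel (X i) = D"
    and D: "prob_space D" "sets D = sets borel"
    and "finite A" and "\<delta> > 0"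
  shows "prob {x \<in> space M. \<bar>(\<Sum>i\<in>I. X i x) - card I * (\<Sum>a\<in>A. a * measure D {a})\<bar> > \<delta>}
    \<le> card I * (1 - (\<Sum>a\<in>A. measure D {a})) + card I * (\<Sum>a\<in>A. a\<^sup>2 * measure D {a}) / \<delta>\<^sup>2"
proof -
  interpret D: prob_space D by fact
  note [simp] = D(2)
  have spaceD: "space D = UNIV"
    using sets_eq_imp_space_eq[of D borel] by simp
  define \<mu> where "\<mu> = (\<Sum>a\<in>A. a * measure D {a})"
  define v where "v = (\<Sum>a\<in>A. a\<^sup>2 * measure D {a})"
  \<comment> \<open>Truncation and centring form one fixed Borel function, so applying it to each
    \<open>X i\<close> preserves independence.\<close>
  define g where "g x = x * indicator A x - \<mu>" for x :: real
  have A[measurable]: "A \<in> sets borel"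
    using \<open>finite A\<close> by (simp add: finite_imp_closed)
  have g[measurable]: "g \<in> borel_measurable borel"
    unfolding g_def by measurable
  note intA = integral_mult_indicator_finite[OF D.finite_measure_axioms D(2) \<open>finite A\<close>]
  \<comment> \<open>An indicator is its own square, so every non-constant term again has the form
    covered by \<open>intA\<close>.\<close>
  have g2: "(g x)\<^sup>2 = x\<^sup>2 * indicator A x - 2 * \<mu> * (x * indicator A x) + \<mu>\<^sup>2" for x
    by (simp add: g_def power2_eq_square algebra_simps indicator_def)
  have Dg: "(\<integral>x. g x \<partial>D) = 0"
    using intA[of "\<lambda>x. x"] by (simp add: g_def \<mu>_def D.prob_space[unfolded spaceD] spaceD)
  have Dg2: "integrable D (\<lambda>x. (g x)\<^sup>2)" "(\<integral>x. (g x)\<^sup>2 \<partial>D) \<le> v"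
  proof -
    show "integrable D (\<lambda>x. (g x)\<^sup>2)"
      unfolding g2 using intA[of "\<lambda>x. x"] intA[of "\<lambda>x. x\<^sup>2"] by simp
    have "(\<integral>x. (g x)\<^sup>2 \<partial>D) = v - \<mu>\<^sup>2"
      unfolding g2 using intA[of "\<lambda>x. x"] intA[of "\<lambda>x. x\<^sup>2"]
      by (simp add: \<mu>_def[symmetric] v_def[symmetric] D.prob_space[unfolded spaceD] spaceD
          power2_eq_square[of \<mu>])
    then show "(\<integral>x. (g x)\<^sup>2 \<partial>D) \<le> v" by simp
  qed
  have rv: "random_variable borel (X i)" if "i \<in> I" for i
    using assms(2) that by (auto simp: indep_vars_def)
  let ?Z = "\<lambda>i x. g (X i x)"
  have "indep_vars (\<lambda>_. borel) ?Z I"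
    using indep_vars_compose2[OF assms(2), of "\<lambda>_. g" "\<lambda>_. borel"] by simp
  \<comment> \<open>Change of variables along \<open>X i\<close> carries the moments of
    \<open>g\<close> under \<open>D\<close> to each summand.\<close>
  have Z: "integrable M (\<lambda>x. (?Z i x)\<^sup>2)" "expectation (?Z i) = 0"
    "expectation (\<lambda>x. (?Z i x)\<^sup>2) \<le> v" if "i \<in> I" for i
    using Dg Dg2 integrable_distr_eq[OF rv[OF that], of "\<lambda>x. (g x)\<^sup>2"]
      integral_distr[OF rv[OF that], of "\<lambda>x. (g x)\<^sup>2"] integral_distr[OF rv[OF that], of g]
    by (simp_all add: distr[OF that])
  let ?T = "\<lambda>x. \<Sum>i\<in>I. ?Z i x"
  have T2: "integrable M (\<lambda>x. (?T x)\<^sup>2)"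
    "expectation (\<lambda>x. (?T x)\<^sup>2) = (\<Sum>i\<in>I. expectation (\<lambda>x. (?Z i x)\<^sup>2))"
    using expectation_square_sum_indep[OF \<open>finite I\<close> \<open>indep_vars (\<lambda>_. borel) ?Z I\<close>] Z(1,2) by auto
  have rvT[measurable]: "random_variable borel ?T"
    using rv by (intro borel_measurable_sum) simp
  have "expectation ?T = 0"
    using Z(2) square_integrable_imp_integrable[OF _ Z(1)] rv by simp
  then have "prob {x \<in> space M. \<delta> \<le> \<bar>?T x\<bar>} \<le> expectation (\<lambda>x. (?T x)\<^sup>2) / \<delta>\<^sup>2"
    using Chebyshev_inequality[OF rvT T2(1) \<open>\<delta> > 0\<close>] by simp
  also have "\<dots> \<le> card I * v / \<delta>\<^sup>2"
    unfolding T2(2) using sum_bounded_above[of I _ v] Z(3) by (intro divide_right_mono) auto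
  finally have cheb: "prob {x \<in> space M. \<delta> \<le> \<bar>?T x\<bar>} \<le> card I * v / \<delta>\<^sup>2" .
  have bad[measurable]: "{x \<in> space M. X i x \<notin> A} \<in> events" if "i \<in> I" for i
    using rv[OF that] by measurable
  have "prob {x \<in> space M. X i x \<notin> A} = 1 - (\<Sum>a\<in>A. measure D {a})" if "i \<in> I" for i
  proof -
    have "measure D (- A) = prob (X i -` (- A) \<inter> space M)"
      using rv[OF that] A by (subst distr[OF that, symmetric]) (auto intro!: measure_distr)
    also have "X i -` (- A) \<inter> space M = {x \<in> space M. X i x \<notin> A}"
      by auto
    finally have "prob {x \<in> space M. X i x \<notin> A} = measure D (- A)" by simp
    also have "\<dots> = 1 - measure D A"
      using D.prob_compl[of A] A by (simp add: spaceD Compl_eq_Diff_UNIV)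
    also have "measure D A = (\<Sum>a\<in>A. measure D {a})"
      using \<open>finite A\<close> by (intro D.finite_measure_eq_sum_singleton) auto
    finally show ?thesis .
  qed
  then have union: "prob (\<Union>i\<in>I. {x \<in> space M. X i x \<notin> A}) \<le> card I * (1 - (\<Sum>a\<in>A. measure D {a}))"
    using finite_measure_subadditive_finite[OF \<open>finite I\<close>, of "\<lambda>i. {x \<in> space M. X i x \<notin> A}"]
    by (simp add: bad image_subset_iff)
  \<comment> \<open>If all \<open>X i x\<close> lie in \<open>A\<close>, then \<open>g\<close> only
    subtracts \<mu>, so \<open>?T x\<close> is exactly the deviation in question.\<close>
  have "{x \<in> space M. \<bar>(\<Sum>i\<in>I. X i x) - card I * \<mu>\<bar> > \<delta>}
    \<subseteq> (\<Union>i\<in>I. {x \<in> space M. X i x \<notin> A}) \<union> {x \<in> space M. \<delta> \<le> \<bar>?T x\<bar>}" (is "?E \<subseteq> ?B \<union> ?C")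
  proof
    fix x assume x: "x \<in> ?E"
    show "x \<in> ?B \<union> ?C"
    proof (cases "x \<in> ?B")
      case False
      then have "X i x \<in> A" if "i \<in> I" for i
        using x that by auto
      then have "?T x = (\<Sum>i\<in>I. X i x - \<mu>)"
        by (intro sum.cong) (auto simp: g_def)
      then show ?thesis
        using x by (simp add: sum_subtractf)
    qed auto
  qed
  moreover have "?B \<in> events"
    using \<open>finite I\<close> bad by auto
  moreover have "?C \<in> events"
    by measurable
  ultimately have "prob ?E \<le> prob ?B + prob ?C"
    by (meson finite_measure_mono measure_Un_le order_trans sets.Un)
  then show ?thesis
    using union cheb unfolding \<mu>_def v_def by linarith
qed

section \<open>The truncated law and the choice of its level\<close>

text \<open>Since r q = 1, every atom contributes the same amount s p to the mean, which therefore
  grows linearly in \<open>m\<close>. The second moment is a geometric sum of ratio r > 1, so it has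
  the order of its last term.\<close>

lemma sum_truncated_geometric_law:
  fixes p q s r :: real
  assumes "0 < p" and "p < 1" and "q = 1 - p" and "s > 0" and "r = 1 / q"
    and mass: "\<And>j. w (s * r ^ j) = p * q ^ j"
  shows "(\<Sum>a\<in>(\<lambda>j. s * r ^ j) ` {..<m}. w a) = 1 - q ^ m"
    and "(\<Sum>a\<in>(\<lambda>j. s * r ^ j) ` {..<m}. a * w a) = s * p * m"
    and "(\<Sum>a\<in>(\<lambda>j. s * r ^ j) ` {..<m}. a\<^sup>2 * w a) \<le> s\<^sup>2 * q * r ^ m"
proof -
  have q: "0 < q" "q < 1" using assms by auto
  then have r: "r > 1" "r * q = 1" using \<open>r = 1 / q\<close> by simp_all
  have rq: "r ^ j * q ^ j = 1" for j
    using r by (simp add: power_mult_distrib[symmetric])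
  \<comment> \<open>The atoms are distinct, so a sum over the set of values is a sum over the
    exponents.\<close>
  have "inj_on (\<lambda>j. s * r ^ j) {..<m}"
    using r \<open>s > 0\<close> by (auto simp: inj_on_def)
  note reindex = sum.reindex[OF this, unfolded comp_def]
  show "(\<Sum>a\<in>(\<lambda>j. s * r ^ j) ` {..<m}. w a) = 1 - q ^ m"
    using q assms(3) one_diff_power_eq[of q m]
    by (simp add: reindex mass sum_distrib_left[symmetric])
  have "s * r ^ j * w (s * r ^ j) = s * p" for j
    using rq[of j] by (simp add: mass)
  then have "(\<Sum>j<m. s * r ^ j * w (s * r ^ j)) = (\<Sum>j<m. s * p)"
    by (intro sum.cong refl)
  then show "(\<Sum>a\<in>(\<lambda>j. s * r ^ j) ` {..<m}. a * w a) = s * p * m"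
    by (simp add: reindex)
  have "(s * r ^ j)\<^sup>2 * w (s * r ^ j) = s\<^sup>2 * p * r ^ j" for j
  proof -
    have "(s * r ^ j)\<^sup>2 * w (s * r ^ j) = s\<^sup>2 * p * r ^ j * (r ^ j * q ^ j)"
      by (simp add: mass power2_eq_square)
    then show ?thesis by (simp add: rq)
  qed
  then have "(\<Sum>a\<in>(\<lambda>j. s * r ^ j) ` {..<m}. a\<^sup>2 * w a) = s\<^sup>2 * (p * (\<Sum>j<m. r ^ j))"
    by (simp add: reindex sum_distrib_left mult.assoc)
  \<comment> \<open>Writing p = q (r - 1) supplies the factor that makes the geometric sum
    telescope.\<close>
  also have "p * (\<Sum>j<m. r ^ j) = q * ((r - 1) * (\<Sum>j<m. r ^ j))"
  proof -
    have "q * (r - 1) = r * q - q"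
      by (simp add: algebra_simps)
    then have "p = q * (r - 1)"
      using r(2) assms(3) by linarith
    then show ?thesis
      by simp
  qed
  also have "\<dots> = q * (r ^ m - 1)"
    by (simp add: power_diff_1_eq)
  also have "s\<^sup>2 * (q * (r ^ m - 1)) \<le> s\<^sup>2 * q * r ^ m"
    using q by (simp add: algebra_simps)
  finally show "(\<Sum>a\<in>(\<lambda>j. s * r ^ j) ` {..<m}. a\<^sup>2 * w a) \<le> s\<^sup>2 * q * r ^ m" .
qed

text \<open>The real number L + log_r L is log_r (x L). Rounding it up raises the exponent by at
  most one, hence the power by at most a factor r.\<close>

lemma truncation_level:
  fixes r L x :: real
  assumes "r > 1" and "x > 0" and "L \<ge> 1" and "L = log r x"
    and "m = nat \<lceil>L + log r L\<rceil>"
  shows "x * L \<le> r ^ m" and "r ^ m \<le> r * (x * L)"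
    and "L + log r L \<le> m" and "m \<le> L + log r L + 1"
proof -
  \<comment> \<open>Nonnegativity ensures that \<open>nat\<close> does not cut the ceiling off at
    0.\<close>
  have nn: "0 \<le> L + log r L"
    using assms(1,3) by simp
  then show m: "L + log r L \<le> m" "m \<le> L + log r L + 1"
    unfolding assms(5) by linarith+
  have pw: "r powr (L + log r L) = x * L"
    using assms(1-4) by (simp add: powr_add)
  have rm: "r ^ m = r powr m"
    using assms(1) by (simp add: powr_realpow)
  show "x * L \<le> r ^ m"
    unfolding rm pw[symmetric] using m(1) assms(1) by simp
  have "r powr m \<le> r powr (L + log r L + 1)"
    using m(2) assms(1) by simp
  also have "\<dots> = r * (x * L)"
    using pw assms(1) by (simp add: powr_add[of r "L + log r L"])
  finally show "r ^ m \<le> r * (x * L)"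
    unfolding rm .
qed

section \<open>Convergence in probability\<close>

theorem theorem2p1:
  fixes p q s r :: real
    and M :: "'a measure"
    and X S :: "nat \<Rightarrow> 'a \<Rightarrow> real"
  assumes "0 < p" and "p < 1" and "q = 1 - p" and "s > 0" and "r = 1 / q"
    and "prob_space M"
    and indep: "prob_space.indep_vars M (\<lambda>_. borel) X {1..}"
    and ident: "\<And>i. i \<ge> 1 \<Longrightarrow> distr M borel (X i) = distr M borel (X 1)"
    and law: "\<And>k::nat. k \<ge> 1 \<Longrightarrow>
      measure M {\<omega> \<in> space M. X 1 \<omega> = s * r ^ (k - 1)} = p * q ^ (k - 1)"
    and S: "\<And>n \<omega>. S n \<omega> = (\<Sum>k=1..n. X k \<omega>)"
  shows "tendsto_in_probability M (\<lambda>n \<omega>. S n \<omega> / (real n * log r (real n))) (\<lambda>_. s * p)"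
proof -
  interpret prob_space M by fact
  have q: "0 < q" "q < 1" using assms(1-3) by auto
  then have r: "r > 1" "r * q = 1" using \<open>r = 1 / q\<close> by simp_all
  have rv: "random_variable borel (X i)" if "i \<ge> 1" for i
    using indep that by (auto simp: indep_vars_def)
  have rvS[measurable]: "random_variable borel (S n)" for n
    unfolding S using rv by (intro borel_measurable_sum) auto
  define D where "D = distr M borel (X 1)"
  have D_ident: "distr M borel (X i) = D" if "i \<ge> 1" for i
    unfolding D_def using that by (rule ident)
  have D: "prob_space D" "sets D = sets borel"
    using prob_space_distr[OF rv[of 1]] by (auto simp: D_def)
  have mass: "measure D {s * r ^ j} = p * q ^ j" for j
  proof -
    have "measure D {s * r ^ j} = prob {\<omega> \<in> space M. X 1 \<omega> = s * r ^ j}"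
      unfolding D_def using rv[of 1]
      by (subst measure_distr) (auto intro!: arg_cong[where f = prob])
    \<comment> \<open>The law is indexed from k = 1, the exponents of the atoms from 0.\<close>
    then show ?thesis using law[of "Suc j"] by simp
  qed
  note moments = sum_truncated_geometric_law[OF assms(1-5), of "\<lambda>a. measure D {a}", OF mass]
  define L where "L n = log r (real n)" for n
  \<comment> \<open>Default values of the logarithms at small \<open>n\<close> do no harm: only
    limits and estimates valid once \<open>L n\<close> \<ge> 1 are used.\<close>
  define m where "m n = nat \<lceil>L n + log r (L n)\<rceil>" for n
  have L_top: "filterlim L at_top sequentially"
    unfolding L_def using r by real_asymp
  have L_ge: "eventually (\<lambda>n. L n \<ge> c) sequentially" for c
    using L_top by (simp add: filterlim_at_top)
  have m_asymp: "(\<lambda>n. m n / L n) \<longlonglongrightarrow> 1"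
  proof (rule tendsto_sandwich)
    \<comment> \<open>Both bounds depend on \<open>n\<close> only through \<open>L n\<close>, so the
      limits are taken in a real variable and composed with \<open>L\<close>.\<close>
    have "((\<lambda>x. (x + log r x) / x) \<longlongrightarrow> 1) at_top" "((\<lambda>x. (x + log r x + 1) / x) \<longlongrightarrow> 1) at_top"
      using r by real_asymp+
    from this[THEN filterlim_compose, OF L_top]
    show "(\<lambda>n. (L n + log r (L n)) / L n) \<longlonglongrightarrow> 1" "(\<lambda>n. (L n + log r (L n) + 1) / L n) \<longlonglongrightarrow> 1"
      by auto
    have "\<forall>\<^sub>F n in sequentially. L n \<ge> 1 \<and> L n + log r (L n) \<le> m n \<and> m n \<le> L n + log r (L n) + 1"
      using L_ge[of 1] eventually_gt_at_top[of 0]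
    proof eventually_elim
      case (elim n)
      then show ?case
        using truncation_level(3,4)[OF r(1) _ elim(1) L_def m_def] by simp
    qed
    then show "\<forall>\<^sub>F n in sequentially. (L n + log r (L n)) / L n \<le> m n / L n"
      "\<forall>\<^sub>F n in sequentially. m n / L n \<le> (L n + log r (L n) + 1) / L n"
      by (auto elim!: eventually_mono intro!: divide_right_mono)
  qed
  show ?thesis
    unfolding tendsto_in_probability_def
  proof (intro conjI allI impI)
    fix \<epsilon> :: real assume \<epsilon>: "\<epsilon> > 0"
    define P where "P n = prob {\<omega> \<in> space M. \<bar>S n \<omega> / (real n * log r n) - s * p\<bar> > \<epsilon>}" for n
    have "(\<lambda>n. s * p * (m n / L n)) \<longlonglongrightarrow> s * p * 1"
      by (intro tendsto_intros m_asymp)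
    \<comment> \<open>Half of \<epsilon> pays for replacing the limit s p by the truncated mean; the
      other half is left for the random deviation.\<close>
    then have "\<forall>\<^sub>F n in sequentially. dist (s * p * (m n / L n)) (s * p * 1) < \<epsilon> / 2"
      using \<epsilon> by (intro tendstoD) auto
    \<comment> \<open>The 1 comes from the union bound, the other term from Chebyshev, where the 4
      is due to halving \<epsilon>.\<close>
    then have upper: "\<forall>\<^sub>F n in sequentially. P n \<le> (1 + 4 * s\<^sup>2 / \<epsilon>\<^sup>2) / L n"
      using L_ge[of 1] eventually_gt_at_top[of 0]
    proof eventually_elim
      case (elim n)
      define b where "b = n * L n"
      have b: "b > 0" using elim by (simp add: b_def)
      have "b \<le> r ^ m n" "r ^ m n \<le> r * b"
        using truncation_level(1,2)[OF r(1) _ elim(2) L_def m_def] elim(3) by (auto simp: b_def)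
      have qm: "q ^ m n \<le> 1 / b"
        using \<open>b \<le> r ^ m n\<close> b q \<open>r = 1 / q\<close> by (simp add: field_simps)
      \<comment> \<open>The factor q of the second moment bound absorbs exactly the factor r lost by
        rounding the level up.\<close>
      have qr: "s\<^sup>2 * q * r ^ m n \<le> s\<^sup>2 * b"
      proof -
        have "q * r ^ m n \<le> q * (r * b)"
          using \<open>r ^ m n \<le> r * b\<close> q by (intro mult_left_mono) auto
        also have "q * (r * b) = (r * q) * b" by simp
        also have "\<dots> = b" using r by simp
        finally show ?thesis
          by (simp add: mult.assoc mult_left_mono)
      qed
      have center: "\<bar>n * (s * p * m n) - b * (s * p)\<bar> < \<epsilon> * b / 2"
      proof -
        have eq: "n * (s * p * m n) - b * (s * p) = b * (s * p * (m n / L n) - s * p)"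
          using elim(2) by (simp add: b_def field_simps)
        have "\<bar>b * (s * p * (m n / L n) - s * p)\<bar> = b * dist (s * p * (m n / L n)) (s * p * 1)"
          using b by (simp add: dist_real_def abs_mult)
        also have "\<dots> < b * (\<epsilon> / 2)"
          using elim(1) b by (rule mult_strict_left_mono)
        finally show ?thesis
          unfolding eq by (simp add: mult.commute)
      qed
      have "P n \<le> prob {\<omega> \<in> space M. \<bar>(\<Sum>k\<in>{1..n}. X k \<omega>) - n * (s * p * m n)\<bar> > \<epsilon> * b / 2}"
        unfolding P_def
      proof (intro finite_measure_mono subsetI)
        fix \<omega> assume "\<omega> \<in> {\<omega> \<in> space M. \<bar>S n \<omega> / (real n * log r n) - s * p\<bar> > \<epsilon>}"
        then have \<omega>: "\<omega> \<in> space M" "\<epsilon> < \<bar>S n \<omega> / b - s * p\<bar>"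
          by (auto simp: b_def L_def)
        have "S n \<omega> / b - s * p = (S n \<omega> - b * (s * p)) / b"
          using b by (simp add: field_simps)
        then have "\<epsilon> * b < \<bar>S n \<omega> - b * (s * p)\<bar>"
          using \<omega>(2) b by (simp add: field_simps)
        \<comment> \<open>Triangle inequality: moving the centre costs less than half of the
          deviation.\<close>
        then have "\<epsilon> * b / 2 < \<bar>S n \<omega> - n * (s * p * m n)\<bar>"
          using center by linarith
        then show "\<omega> \<in> {\<omega> \<in> space M. \<bar>(\<Sum>k\<in>{1..n}. X k \<omega>) - n * (s * p * m n)\<bar> > \<epsilon> * b / 2}"
          using \<omega>(1) by (simp add: S)
      next
        have "{\<omega> \<in> space M. \<bar>S n \<omega> - n * (s * p * m n)\<bar> > \<epsilon> * b / 2} \<in> events"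
          by measurable
        then show "{\<omega> \<in> space M. \<bar>(\<Sum>k\<in>{1..n}. X k \<omega>) - n * (s * p * m n)\<bar> > \<epsilon> * b / 2} \<in> events"
          by (simp add: S)
      qed
      \<comment> \<open>Here \<open>A\<close> consists of the \<open>m n\<close> smallest values:
        the mass outside it is \<open>q ^ m n\<close> and the truncated mean is
        \<open>s * p * m n\<close>.\<close>
      also have "\<dots> \<le> n * q ^ m n
        + n * (\<Sum>a\<in>(\<lambda>j. s * r ^ j) ` {..<m n}. a\<^sup>2 * measure D {a}) / (\<epsilon> * b / 2)\<^sup>2"
        using truncated_sum_deviation[of "{1..n}" X D "(\<lambda>j. s * r ^ j) ` {..<m n}" "\<epsilon> * b / 2"]
          indep_vars_subset[OF indep, of "{1..n}"] D_ident D \<epsilon> b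
        by (simp add: moments(1,2))
      also have "\<dots> \<le> n * (1 / b) + n * (s\<^sup>2 * b) / (\<epsilon> * b / 2)\<^sup>2"
        using qm order_trans[OF moments(3) qr]
        by (intro add_mono mult_left_mono divide_right_mono) auto
      also have "\<dots> = (1 + 4 * s\<^sup>2 / \<epsilon>\<^sup>2) / L n"
        using elim(2,3) \<epsilon> by (simp add: b_def field_simps power2_eq_square)
      finally show ?case .
    qed
    have lower: "\<forall>\<^sub>F n in sequentially. 0 \<le> P n"
      by (simp add: P_def)
    have "(\<lambda>n. (1 + 4 * s\<^sup>2 / \<epsilon>\<^sup>2) / L n) \<longlonglongrightarrow> 0"
      by (rule tendsto_divide_0[OF tendsto_const filterlim_at_top_imp_at_infinity[OF L_top]])
    then have "P \<longlonglongrightarrow> 0"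
      by (rule tendsto_sandwich[OF lower upper tendsto_const])
    then show "(\<lambda>n. prob {\<omega> \<in> space M. \<epsilon> < \<bar>S n \<omega> / (real n * log r n) - s * p\<bar>}) \<longlonglongrightarrow> 0"
      unfolding P_def .
  \<comment> \<open>What remains is measurability of the normalised sums and of the constant
    limit.\<close>
  qed auto
qed

end
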